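(* Let $X,G$ be bounded degree graphs, with adjacency operators $A,B$, and let $Y$ be an additive perturbation of $X$ whose adjacency operator on $\ell^2(Y)=\ell^2(X)\oplus\ell^2(G)$ is $$A_p=\begin{pmatrix}A+D&C\\ C^t&B\end{pmatrix}.$$ Suppose first that $Y$ is a finite perturbation of the essentially periodic graph $X$ (so $G$ is finite and $B,C,D$ have finite rank). Let $\lambda\in\mathbb C$ with $|\lambda|>\|A_p\|$ and $v=\begin{pmatrix} x \\ y \end{pmatrix}\in\ell^2(Y)$. Then $$R_{A_p}(\lambda)v=\begin{pmatrix}R_A(\lambda)(x+z)\\ R_B(\lambda)\big(C^tR_A(\lambda)x+y+C^tR_A(\lambda)z\big)\end{pmatrix},$$ where $$z=(I-S(\lambda))^{-1}\Big(\big(DR_A(\lambda)+CR_B(\lambda)C^tR_A(\lambda)\big)x+CR_B(\lambda)y\Big).$$ If $|\lambda|$ is sufficiently large, the formula holds also for infinite additive perturbations with density zero.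
   Context: $R_T(\lambda)=(\lambda I-T)^{-1}$. $D$ (with nonnegative entries, since the perturbation is additive, i.e. only adds edges and vertices) describes the edges added between vertices of $X$, and $C:\ell^2(G)\to\ell^2(X)$ describes the edges linking $G$ to $X$; $Y$ has bounded degree, so $C,D$ are bounded. $S(\lambda)=\big(DR_A(\lambda)+CR_B(\lambda)C^tR_A(\lambda)\big)|_{\overline{\mathcal R(C)+\mathcal R(D)}}$, where $\mathcal R$ denotes the range, regarded as an operator on the closed subspace $\overline{\mathcal R(C)+\mathcal R(D)}\subset\ell^2(X)$. An amenable exhaustion of an infinite graph is an increasing exhaustion by finite subgraphs $K_n$ with $|\mathcal FK_n|/|VK_n|\to0$, where $\mathcal FK_n=\{v\in VK_n:d(v,VX\setminus VK_n)=1\}$; $P_n$ is the projection onto $\ell^2(VK_n)$. A periodic amenable graph is an infinite graph with a countable discrete amenable group of automorphisms acting freely with finite quotient, together with an amenable exhaustion made, up to boundary vertices, of unions of translates of a fundamental domain. A density zero perturbation is one for which the difference $T$ of the adjacency operators satisfies $\frac{1}{|VK_n|}\mathrm{Tr}(T^2P_n)\to0$. An essentially periodic graph is a finite and/or density zero perturbation of a periodic amenable graph. *)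

theory Defs
  imports "HOL-Analysis.Analysis" "HOL-Algebra.Bij" "HOL-Algebra.Group_Action"
begin

section \<open>Graphs\<close>

text \<open>Graphs are simple and undirected, and not necessarily connected.  The vertex set is a set
  rather than a type, so that it may be empty and so that graphs on different vertex sets
  can be compared.\<close>

record 'v ugraph =
  verts :: "'v set"
  adj :: "'v \<Rightarrow> 'v \<Rightarrow> bool"

definition simple_graph :: "'v ugraph \<Rightarrow> bool" where
  "simple_graph X \<longleftrightarrow>
     (\<forall>u v. adj X u v \<longrightarrow> u \<in> verts X \<and> v \<in> verts X \<and> u \<noteq> v \<and> adj X v u)"

definition bounded_degree_graph :: "'v ugraph \<Rightarrow> bool" where
  "bounded_degree_graph X \<longleftrightarrow> simple_graph X \<and>
     (\<exists>m::nat. \<forall>v\<in>verts X. finite {w. adj X v w} \<and> card {w. adj X v w} \<le> m)"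

definition subgraph_of :: "'v ugraph \<Rightarrow> 'v ugraph \<Rightarrow> bool" where
  "subgraph_of K X \<longleftrightarrow> simple_graph K \<and> verts K \<subseteq> verts X \<and> (\<forall>u v. adj K u v \<longrightarrow> adj X u v)"

definition map_graph :: "('v \<Rightarrow> 'w) \<Rightarrow> 'v ugraph \<Rightarrow> 'w ugraph" where
  "map_graph f X = \<lparr>verts = f ` verts X, adj = (\<lambda>a b. \<exists>u v. a = f u \<and> b = f v \<and> adj X u v)\<rparr>"

text \<open>Distance from a vertex to a set of vertices; it is infinite if no walk exists.\<close>

definition set_distance :: "'v ugraph \<Rightarrow> 'v \<Rightarrow> 'v set \<Rightarrow> enat" where
  "set_distance X v S = Inf (enat ` {k. \<exists>w\<in>S. (adj X ^^ k) v w})"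

definition frontier_of_subgraph :: "'v ugraph \<Rightarrow> 'v ugraph \<Rightarrow> 'v set" where
  "frontier_of_subgraph X K = {v \<in> verts K. set_distance X v (verts X - verts K) = 1}"

definition amenable_exhaustion :: "'v ugraph \<Rightarrow> (nat \<Rightarrow> 'v ugraph) \<Rightarrow> bool" where
  "amenable_exhaustion X K \<longleftrightarrow>
     infinite (verts X) \<and>
     (\<forall>n. finite (verts (K n)) \<and> subgraph_of (K n) X \<and> subgraph_of (K n) (K (Suc n))) \<and>
     (\<Union>n. verts (K n)) = verts X \<and>
     (\<forall>u v. adj X u v \<longrightarrow> (\<exists>n. adj (K n) u v)) \<and>
     (\<lambda>n. real (card (frontier_of_subgraph X (K n))) / real (card (verts (K n)))) \<longlonglongrightarrow> 0"

text \<open>Amenability of a discrete group: existence of a left-invariant finitely additive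
  probability measure on all subsets.\<close>

definition amenable_group :: "('g, 'b) monoid_scheme \<Rightarrow> bool" where
  "amenable_group \<Gamma> \<longleftrightarrow> group \<Gamma> \<and>
     (\<exists>\<mu> :: 'g set \<Rightarrow> real.
        (\<forall>S. S \<subseteq> carrier \<Gamma> \<longrightarrow> 0 \<le> \<mu> S) \<and>
        \<mu> (carrier \<Gamma>) = 1 \<and>
        (\<forall>S U. S \<subseteq> carrier \<Gamma> \<and> U \<subseteq> carrier \<Gamma> \<and> S \<inter> U = {} \<longrightarrow> \<mu> (S \<union> U) = \<mu> S + \<mu> U) \<and>
        (\<forall>g\<in>carrier \<Gamma>. \<forall>S. S \<subseteq> carrier \<Gamma> \<longrightarrow> \<mu> ((\<lambda>h. g \<otimes>\<^bsub>\<Gamma>\<^esub> h) ` S) = \<mu> S))"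

text \<open>The exhaustion is part of the data of a periodic amenable graph.  For graphs of bounded
  degree, finiteness of the quotient amounts to finiteness of the set of vertex orbits.
  The phrase ``up to boundary vertices'' means that each \<open>verts (K n)\<close> differs from a union of
  translates of the fundamental domain \<open>F\<close> only in vertices of the frontier of \<open>K n\<close>.\<close>

definition periodic_amenable_graph :: "'v ugraph \<Rightarrow> (nat \<Rightarrow> 'v ugraph) \<Rightarrow> bool" where
  "periodic_amenable_graph X K \<longleftrightarrow>
     bounded_degree_graph X \<and> amenable_exhaustion X K \<and>
     (\<exists>\<Gamma> F.
        subgroup \<Gamma> (BijGroup (verts X)) \<and>
        (\<forall>\<gamma>\<in>\<Gamma>. \<forall>u\<in>verts X. \<forall>v\<in>verts X. adj X (\<gamma> u) (\<gamma> v) \<longleftrightarrow> adj X u v) \<and>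
        countable \<Gamma> \<and>
        amenable_group (BijGroup (verts X) \<lparr>carrier := \<Gamma>\<rparr>) \<and>
        (\<forall>\<gamma>\<in>\<Gamma>. \<forall>v\<in>verts X. \<gamma> v = v \<longrightarrow> \<gamma> = \<one>\<^bsub>BijGroup (verts X)\<^esub>) \<and>
        finite (orbits (BijGroup (verts X) \<lparr>carrier := \<Gamma>\<rparr>) (verts X) (\<lambda>\<gamma>. \<gamma>)) \<and>
        F \<subseteq> verts X \<and>
        (\<forall>v\<in>verts X. \<exists>!u. u \<in> F \<and> (\<exists>\<gamma>\<in>\<Gamma>. v = \<gamma> u)) \<and>
        (\<forall>n. \<exists>E\<subseteq>\<Gamma>. sym_diff (verts (K n)) (\<Union>\<gamma>\<in>E. \<gamma> ` F) \<subseteq> frontier_of_subgraph X (K n)))"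


section \<open>The Hilbert space of square-summable functions\<close>

typedef 'v ell2 = "{f :: 'v \<Rightarrow> complex. (\<lambda>v. (cmod (f v))\<^sup>2) summable_on UNIV}"
  morphisms coord Abs_ell2
  by (rule exI[of _ "\<lambda>_. 0"]) simp

lemma coord_summable: "(\<lambda>v. (cmod (coord f v))\<^sup>2) summable_on UNIV"
  using coord[of f] by simp

lemma ell2_eqI: "(\<And>v. coord f v = coord g v) \<Longrightarrow> f = g"
  by (metis coord_inject ext)

lemma coord_Abs:
  "(\<lambda>v. (cmod (f v))\<^sup>2) summable_on UNIV \<Longrightarrow> coord (Abs_ell2 f) = f"
  by (simp add: Abs_ell2_inverse)

lemma square_summable_add:
  assumes "(\<lambda>v. (cmod (f v))\<^sup>2) summable_on A" "(\<lambda>v. (cmod (g v))\<^sup>2) summable_on A"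
  shows "(\<lambda>v. (cmod (f v + g v))\<^sup>2) summable_on A"
proof (rule summable_on_comparison_test)
  show "(\<lambda>v. 2 * (cmod (f v))\<^sup>2 + 2 * (cmod (g v))\<^sup>2) summable_on A"
    using assms by (intro summable_on_add summable_on_cmult_right)
  fix v
  have "(cmod (f v + g v))\<^sup>2 \<le> (cmod (f v) + cmod (g v))\<^sup>2"
    by (intro power_mono norm_triangle_ineq) auto
  also have "\<dots> \<le> 2 * (cmod (f v))\<^sup>2 + 2 * (cmod (g v))\<^sup>2"
    using zero_le_power2[of "cmod (f v) - cmod (g v)"]
    by (simp add: power2_eq_square algebra_simps)
  finally show "(cmod (f v + g v))\<^sup>2 \<le> 2 * (cmod (f v))\<^sup>2 + 2 * (cmod (g v))\<^sup>2" .
qed auto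

lemma square_summable_mult:
  assumes "(\<lambda>v. (cmod (f v))\<^sup>2) summable_on A"
  shows "(\<lambda>v. (cmod (c * f v))\<^sup>2) summable_on A"
  using summable_on_cmult_right[OF assms, of "(cmod c)\<^sup>2"]
  by (simp add: norm_mult power_mult_distrib)

lemma inner_summable:
  assumes "(\<lambda>v. (cmod (f v))\<^sup>2) summable_on A" "(\<lambda>v. (cmod (g v))\<^sup>2) summable_on A"
  shows "(\<lambda>v. f v \<bullet> g v) summable_on A"
proof -
  have eq: "f v \<bullet> g v = 1/2 * (cmod (f v + g v))\<^sup>2 + (- (1/2) * (cmod (f v))\<^sup>2 + - (1/2) * (cmod (g v))\<^sup>2)"
    for v
    by (simp add: power2_norm_eq_inner inner_add inner_commute[of "g v" "f v"] field_simps)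
  show ?thesis
    unfolding eq using assms
    by (intro summable_on_add summable_on_cmult_right square_summable_add)
qed

instantiation ell2 :: (type) real_vector
begin

definition zero_ell2 :: "'a ell2" where "0 = Abs_ell2 (\<lambda>_. 0)"
definition plus_ell2 :: "'a ell2 \<Rightarrow> 'a ell2 \<Rightarrow> 'a ell2" where
  "f + g = Abs_ell2 (\<lambda>v. coord f v + coord g v)"
definition uminus_ell2 :: "'a ell2 \<Rightarrow> 'a ell2" where
  "- f = Abs_ell2 (\<lambda>v. - coord f v)"
definition minus_ell2 :: "'a ell2 \<Rightarrow> 'a ell2 \<Rightarrow> 'a ell2" where
  "f - g = f + (- g :: 'a ell2)"
definition scaleR_ell2 :: "real \<Rightarrow> 'a ell2 \<Rightarrow> 'a ell2" where
  "r *\<^sub>R f = Abs_ell2 (\<lambda>v. of_real r * coord f v)"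

lemma coord_zero: "coord (0 :: 'a ell2) v = 0"
  by (simp add: zero_ell2_def coord_Abs)
lemma coord_plus: "coord (f + g :: 'a ell2) v = coord f v + coord g v"
  unfolding plus_ell2_def by (subst coord_Abs) (auto intro: square_summable_add coord_summable)
lemma coord_uminus: "coord (- f :: 'a ell2) v = - coord f v"
  unfolding uminus_ell2_def by (subst coord_Abs) (auto intro: coord_summable)
lemma coord_minus: "coord (f - g :: 'a ell2) v = coord f v - coord g v"
  unfolding minus_ell2_def by (simp add: coord_plus coord_uminus)
lemma coord_scaleR: "coord (r *\<^sub>R f :: 'a ell2) v = of_real r * coord f v"
  unfolding scaleR_ell2_def
  by (subst coord_Abs) (rule square_summable_mult coord_summable refl)+

instance
proof
  fix f g h :: "'a ell2" and r s :: real
  show "f + g + h = f + (g + h)" "f + g = g + f" "0 + f = f" "- f + f = 0" "f - g = f + - g"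
    by (auto intro!: ell2_eqI simp: coord_plus coord_zero coord_uminus coord_minus)
  show "r *\<^sub>R (f + g) = r *\<^sub>R f + r *\<^sub>R g" "(r + s) *\<^sub>R f = r *\<^sub>R f + s *\<^sub>R f"
    "r *\<^sub>R s *\<^sub>R f = (r * s) *\<^sub>R f" "1 *\<^sub>R f = f"
    by (auto intro!: ell2_eqI simp: coord_plus coord_scaleR algebra_simps)
qed

end

instantiation ell2 :: (type) real_inner
begin

text \<open>The class \<open>real_inner\<close> only provides the real part of the Hermitian inner product.\<close>

definition inner_ell2 :: "'a ell2 \<Rightarrow> 'a ell2 \<Rightarrow> real" where
  "inner_ell2 f g = (\<Sum>\<^sub>\<infinity>v. coord f v \<bullet> coord g v)"
definition norm_ell2 :: "'a ell2 \<Rightarrow> real" where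
  "norm_ell2 f = sqrt (\<Sum>\<^sub>\<infinity>v. (cmod (coord f v))\<^sup>2)"
definition dist_ell2 :: "'a ell2 \<Rightarrow> 'a ell2 \<Rightarrow> real" where
  "dist_ell2 f g = norm (f - g)"
definition sgn_ell2 :: "'a ell2 \<Rightarrow> 'a ell2" where
  "sgn_ell2 f = inverse (norm f) *\<^sub>R f"
definition uniformity_ell2 :: "('a ell2 \<times> 'a ell2) filter" where
  "uniformity_ell2 = (INF e\<in>{0 <..}. principal {(f, g :: 'a ell2). dist f g < e})"
definition open_ell2 :: "'a ell2 set \<Rightarrow> bool" where
  "open_ell2 U = (\<forall>x\<in>U. eventually (\<lambda>(x', y). x' = x \<longrightarrow> y \<in> U) uniformity)"

instance
proof
  fix f g h :: "'a ell2" and r :: real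
  show "sgn f = f /\<^sub>R norm f" "dist f g = norm (f - g)"
    by (simp_all add: sgn_ell2_def dist_ell2_def)
  show "uniformity = (INF e\<in>{0 <..}. principal {(f, g :: 'a ell2). dist f g < e})"
    by (rule uniformity_ell2_def)
  show "open U = (\<forall>x\<in>U. \<forall>\<^sub>F (x', y) in uniformity. x' = x \<longrightarrow> y \<in> U)" for U :: "'a ell2 set"
    by (rule open_ell2_def)
  have sum: "(\<lambda>v. coord f v \<bullet> coord g v) summable_on UNIV" for f g :: "'a ell2"
    by (intro inner_summable coord_summable)
  show "f \<bullet> g = g \<bullet> f"
    by (simp add: inner_ell2_def inner_commute)
  show "(f + g) \<bullet> h = f \<bullet> h + g \<bullet> h"
    by (simp add: inner_ell2_def coord_plus inner_add_left infsum_add sum)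
  have "(\<Sum>\<^sub>\<infinity>v. (of_real r * coord f v) \<bullet> coord g v) = (\<Sum>\<^sub>\<infinity>v. r * (coord f v \<bullet> coord g v))"
    by (intro infsum_cong) (simp add: inner_complex_def algebra_simps)
  then show "r *\<^sub>R f \<bullet> g = r * (f \<bullet> g)"
    by (simp add: inner_ell2_def coord_scaleR infsum_cmult_right sum)
  show "0 \<le> f \<bullet> f"
    by (simp add: inner_ell2_def infsum_nonneg)
  show "norm f = sqrt (f \<bullet> f)"
    by (simp add: norm_ell2_def inner_ell2_def power2_norm_eq_inner)
  show "f \<bullet> f = 0 \<longleftrightarrow> f = 0"
  proof
    assume "f \<bullet> f = 0"
    then have "coord f v \<bullet> coord f v = 0" for v
      using nonneg_infsum_le_0D[of "\<lambda>v. coord f v \<bullet> coord f v" UNIV v] sum[of f f]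
      by (simp add: inner_ell2_def)
    then show "f = 0"
      by (auto intro!: ell2_eqI simp: coord_zero)
  qed (simp add: inner_ell2_def coord_zero)
qed

end

definition scaleC :: "complex \<Rightarrow> 'v ell2 \<Rightarrow> 'v ell2" where
  "scaleC c f = Abs_ell2 (\<lambda>v. c * coord f v)"

lemma coord_scaleC: "coord (scaleC c f) v = c * coord f v"
  unfolding scaleC_def
  by (subst coord_Abs) (rule square_summable_mult coord_summable refl)+

text \<open>The space \<open>\<ell>\<^sup>2(V)\<close> for a set \<open>V\<close> of vertices, as a closed subspace.\<close>

definition ell2_on :: "'v set \<Rightarrow> 'v ell2 set" where
  "ell2_on V = {f. \<forall>v. v \<notin> V \<longrightarrow> coord f v = 0}"

definition delta :: "'v \<Rightarrow> 'v ell2" where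
  "delta v = Abs_ell2 (\<lambda>w. if w = v then 1 else 0)"

definition proj_ell2 :: "'v set \<Rightarrow> 'v ell2 \<Rightarrow> 'v ell2" where
  "proj_ell2 V f = Abs_ell2 (\<lambda>v. if v \<in> V then coord f v else 0)"

text \<open>The column vector with entries \<open>x\<close> and \<open>y\<close>, identifying \<open>\<ell>\<^sup>2(X) \<oplus> \<ell>\<^sup>2(G)\<close> with
  \<open>\<ell>\<^sup>2\<close> of the disjoint union.\<close>

definition column_vec :: "'x ell2 \<Rightarrow> 'g ell2 \<Rightarrow> ('x + 'g) ell2" where
  "column_vec x y = Abs_ell2 (case_sum (coord x) (coord y))"

lemma coord_delta: "coord (delta v) w = (if w = v then 1 else 0)"
proof -
  have "(\<lambda>w. (cmod (if w = v then 1 else 0))\<^sup>2) summable_on UNIV"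
    by (rule finite_nonzero_values_imp_summable_on) (rule finite_subset[of _ "{v}"], auto)
  then show ?thesis
    unfolding delta_def by (subst coord_Abs) auto
qed

lemma coord_proj_ell2: "coord (proj_ell2 V f) v = (if v \<in> V then coord f v else 0)"
proof -
  have "(\<lambda>v. (cmod (if v \<in> V then coord f v else 0))\<^sup>2) summable_on UNIV"
    by (rule summable_on_comparison_test[OF coord_summable[of f]]) auto
  then show ?thesis
    unfolding proj_ell2_def by (subst coord_Abs) auto
qed

lemma coord_column_vec:
  "coord (column_vec x y) (Inl u) = coord x u" "coord (column_vec x y) (Inr g) = coord y g"
proof -
  let ?h = "\<lambda>v. (cmod (case_sum (coord x) (coord y) v))\<^sup>2"
  have "?h summable_on (range Inl)" "?h summable_on (range Inr)"
    by (subst summable_on_reindex; simp add: o_def coord_summable)+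
  then have "?h summable_on (range Inl \<union> range Inr)"
    by (rule summable_on_Un_disjoint) auto
  then have "?h summable_on UNIV"
    by (simp add: UNIV_sum)
  then show "coord (column_vec x y) (Inl u) = coord x u" "coord (column_vec x y) (Inr g) = coord y g"
    by (simp_all add: column_vec_def coord_Abs)
qed


section \<open>Operators\<close>

text \<open>The operator with a given matrix.  It is only meaningful if the matrix
  maps \<open>\<ell>\<^sup>2\<close> to \<open>\<ell>\<^sup>2\<close>.\<close>

definition matrix_op :: "('w \<Rightarrow> 'v \<Rightarrow> real) \<Rightarrow> 'v ell2 \<Rightarrow> 'w ell2" where
  "matrix_op M f = Abs_ell2 (\<lambda>w. \<Sum>\<^sub>\<infinity>v. of_real (M w v) * coord f v)"

definition block_matrix ::
  "('x \<Rightarrow> 'x \<Rightarrow> real) \<Rightarrow> ('x \<Rightarrow> 'g \<Rightarrow> real) \<Rightarrow> ('g \<Rightarrow> 'x \<Rightarrow> real) \<Rightarrow> ('g \<Rightarrow> 'g \<Rightarrow> real)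
    \<Rightarrow> 'x + 'g \<Rightarrow> 'x + 'g \<Rightarrow> real" where
  "block_matrix M11 M12 M21 M22 =
     case_sum (\<lambda>u. case_sum (M11 u) (M12 u)) (\<lambda>g. case_sum (M21 g) (M22 g))"

definition adj_matrix :: "'v ugraph \<Rightarrow> 'v \<Rightarrow> 'v \<Rightarrow> real" where
  "adj_matrix X u v = (if adj X u v then 1 else 0)"

text \<open>The adjacency operator on \<open>\<ell>\<^sup>2(X)\<close>, extended by zero on the orthogonal complement of
  \<open>ell2_on (verts X)\<close>; in particular \<open>onorm\<close> is its operator norm on \<open>\<ell>\<^sup>2(X)\<close>.\<close>

definition adj_op :: "'v ugraph \<Rightarrow> 'v ell2 \<Rightarrow> 'v ell2" where
  "adj_op X = matrix_op (adj_matrix X)"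

definition boundedly_invertible_on :: "'v ell2 set \<Rightarrow> ('v ell2 \<Rightarrow> 'v ell2) \<Rightarrow> bool" where
  "boundedly_invertible_on H T \<longleftrightarrow>
     bij_betw T H H \<and> (\<exists>K. \<forall>f\<in>H. norm (inv_into H T f) \<le> K * norm f)"

definition resolvent_set :: "'v ell2 set \<Rightarrow> ('v ell2 \<Rightarrow> 'v ell2) \<Rightarrow> complex set" where
  "resolvent_set H T = {lam. boundedly_invertible_on H (\<lambda>f. scaleC lam f - T f)}"

definition resolvent ::
  "'v ell2 set \<Rightarrow> ('v ell2 \<Rightarrow> 'v ell2) \<Rightarrow> complex \<Rightarrow> 'v ell2 \<Rightarrow> 'v ell2" where
  "resolvent H T lam = inv_into H (\<lambda>f. scaleC lam f - T f)"

definition op_trace :: "('v ell2 \<Rightarrow> 'v ell2) \<Rightarrow> complex" where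
  "op_trace T = (\<Sum>\<^sub>\<infinity>v. coord (T (delta v)) v)"


section \<open>Perturbations\<close>

text \<open>Here both graphs have vertices in a common ambient type; vertices may be added or deleted.\<close>

definition finite_perturbation :: "'v ugraph \<Rightarrow> 'v ugraph \<Rightarrow> bool" where
  "finite_perturbation X Y \<longleftrightarrow>
     finite (sym_diff (verts X) (verts Y)) \<and> finite {(u, v). adj X u v \<noteq> adj Y u v}"

text \<open>\<open>K\<close> is an exhaustion of the unperturbed graph \<open>X\<close>.  The difference of the adjacency
  operators is formed on the whole ambient space, where either operator is extended by zero.\<close>

definition density_zero_perturbation ::
  "(nat \<Rightarrow> 'v ugraph) \<Rightarrow> 'v ugraph \<Rightarrow> 'v ugraph \<Rightarrow> bool" where
  "density_zero_perturbation K X Y \<longleftrightarrow>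
     (let T = (\<lambda>f. adj_op Y f - adj_op X f)
      in (\<lambda>n. op_trace (T \<circ> T \<circ> proj_ell2 (verts (K n))) / of_nat (card (verts (K n))))
           \<longlonglongrightarrow> 0)"

text \<open>The underlying periodic graph \<open>X0\<close> may have vertices that were deleted in \<open>X\<close>, so it lives on
  a type with room for countably many additional vertices.  The intermediate graph \<open>Z\<close> accounts
  for ``and/or'': a graph is both a finite and a density zero perturbation of itself.\<close>

definition essentially_periodic_graph :: "'v ugraph \<Rightarrow> bool" where
  "essentially_periodic_graph X \<longleftrightarrow>
     (\<exists>(X0 :: ('v + nat) ugraph) K Z.
        periodic_amenable_graph X0 K \<and>
        bounded_degree_graph Z \<and>
        density_zero_perturbation K X0 Z \<and>
        finite_perturbation Z (map_graph Inl X))"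

end

theory Submission
  imports Defs
begin

text \<open>The blocks of \<open>A\<^sub>p\<close> are entrywise dominated by \<open>A\<^sub>p\<close> and all entries are nonnegative, so none
  of them has a larger norm; hence all three resolvents exist as soon as \<open>\<bar>lam\<bar> > \<parallel>A\<^sub>p\<parallel>\<close>.
  For such \<open>lam\<close> the operator \<open>I - S\<close> is the Schur complement of \<open>lam - B\<close> in
  \<open>lam - A\<^sub>p\<close>, composed with \<open>R\<^sub>A\<close>, so it is invertible on \<open>\<ell>\<^sup>2(X)\<close>.  As \<open>S\<close> maps into
  \<open>W\<close>, the solution \<open>f = w + S f\<close> of \<open>(I - S) f = w\<close> stays in \<open>W\<close> whenever \<open>w \<in> W\<close>.
  Thus \<open>L = \<parallel>A\<^sub>p\<parallel>\<close> serves in the infinite case as well.\<close>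

section \<open>Finite partial sums, closed subspaces and completeness of \<open>ell2\<close>\<close>

lemma sum_coord_le_norm:
  assumes "finite F"
  shows "(\<Sum>v\<in>F. (cmod (coord f v))\<^sup>2) \<le> (norm f)\<^sup>2"
proof -
  have "(norm f)\<^sup>2 = (\<Sum>\<^sub>\<infinity>v. (cmod (coord f v))\<^sup>2)"
    by (simp add: norm_ell2_def infsum_nonneg)
  then show ?thesis
    using finite_sum_le_infsum[OF coord_summable[of f] assms] by simp
qed

lemma norm_coord_le: "cmod (coord f v) \<le> norm f"
  using sum_coord_le_norm[of "{v}" f]
  by (simp add: power_mono_iff)

text \<open>Bounded finite partial sums of nonnegative terms are summable. With
  \<open>norm_ell2_le\<close>, this reduces membership in \<open>ell2\<close> and norm estimates to
  finite sums.\<close>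

lemma square_summable_bound:
  assumes "\<And>F. finite F \<Longrightarrow> (\<Sum>v\<in>F. (cmod (f v))\<^sup>2) \<le> b"
  shows "(\<lambda>v. (cmod (f v))\<^sup>2) summable_on UNIV"
  using assms
  by (intro nonneg_bounded_partial_sums_imp_summable_on[where C = b]
      eventually_finite_subsets_at_top_weakI) simp_all

lemma norm_ell2_le:
  assumes "0 \<le> b" "\<And>F. finite F \<Longrightarrow> (\<Sum>v\<in>F. (cmod (coord f v))\<^sup>2) \<le> b\<^sup>2"
  shows "norm f \<le> b"
proof -
  have "(\<Sum>\<^sub>\<infinity>v. (cmod (coord f v))\<^sup>2) \<le> b\<^sup>2"
    using assms(2) by (intro infsum_le_finite_sums coord_summable) auto
  then show ?thesis
    using assms(1) by (simp add: norm_ell2_def real_le_lsqrt infsum_nonneg)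
qed

text \<open>Each coordinate is 1-Lipschitz by \<open>norm_coord_le\<close>.\<close>

lemma tendsto_coord:
  assumes "(f \<longlongrightarrow> g) F"
  shows "((\<lambda>n. coord (f n) v) \<longlongrightarrow> coord g v) F"
proof (rule metric_tendsto_imp_tendsto[OF assms])
  show "\<forall>\<^sub>F n in F. dist (coord (f n) v) (coord g v) \<le> dist (f n) g"
    using norm_coord_le[of "f _ - g" v] by (simp add: dist_norm coord_minus)
qed

lemma closed_ell2_on: "closed (ell2_on V)"
proof (unfold closed_sequential_limits, intro allI impI, elim conjE)
  fix f g assume f: "\<forall>n. f n \<in> ell2_on V" and lim: "f \<longlonglongrightarrow> g"
  show "g \<in> ell2_on V"
    unfolding ell2_on_def
  proof (intro CollectI allI impI)
    fix v assume "v \<notin> V"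
    then have "(\<lambda>n. coord (f n) v) = (\<lambda>_. 0)"
      using f by (auto simp: ell2_on_def)
    then show "coord g v = 0"
      using tendsto_coord[OF lim, of v] by (simp add: tendsto_const_iff)
  qed
qed

lemma subspace_ell2_on: "subspace (ell2_on V)"
  by (auto simp: subspace_def ell2_on_def coord_zero coord_plus coord_scaleR)

text \<open>The limit is taken coordinatewise, and uniform bounds on finite sums turn this into
  convergence in norm. Completeness is what the Banach fixed point argument for resolvents rests
  on.\<close>

instance ell2 :: (type) complete_space
proof
  fix f :: "nat \<Rightarrow> 'a ell2"
  assume cauchy: "Cauchy f"
  have "\<exists>l. (\<lambda>n. coord (f n) v) \<longlonglongrightarrow> l" for v
  proof -
    have "Cauchy (\<lambda>n. coord (f n) v)"
      unfolding Cauchy_def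
    proof (intro allI impI)
      fix e :: real assume "e > 0"
      then obtain M where "\<forall>m\<ge>M. \<forall>n\<ge>M. dist (f m) (f n) < e"
        using cauchy by (auto simp: Cauchy_def)
      then show "\<exists>M. \<forall>m\<ge>M. \<forall>n\<ge>M. dist (coord (f m) v) (coord (f n) v) < e"
        by (intro exI[of _ M])
          (auto simp: dist_norm simp flip: coord_minus intro: le_less_trans[OF norm_coord_le])
    qed
    then show ?thesis
      by (simp add: Cauchy_convergent_iff convergent_def)
  qed
  then obtain h where h: "\<And>v. (\<lambda>n. coord (f n) v) \<longlonglongrightarrow> h v"
    by metis
  \<comment> \<open>Let \<open>m\<close> tend to infinity in the Cauchy estimate while the finite
    set \<open>F\<close> stays fixed. The same inequality serves first for the square-summability of
    \<open>h\<close>, then for convergence.\<close>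
  have tail: "(\<Sum>v\<in>F. (cmod (coord (f n) v - h v))\<^sup>2) \<le> e\<^sup>2"
    if "finite F" and M: "\<And>m. m \<ge> M \<Longrightarrow> norm (f n - f m) \<le> e" for F n M e
  proof (rule tendsto_upperbound)
    show "(\<lambda>m. \<Sum>v\<in>F. (cmod (coord (f n) v - coord (f m) v))\<^sup>2)
        \<longlonglongrightarrow> (\<Sum>v\<in>F. (cmod (coord (f n) v - h v))\<^sup>2)"
      by (intro tendsto_intros h)
    show "\<forall>\<^sub>F m in sequentially. (\<Sum>v\<in>F. (cmod (coord (f n) v - coord (f m) v))\<^sup>2) \<le> e\<^sup>2"
    proof (rule eventually_sequentiallyI)
      fix m assume "M \<le> m"
      then show "(\<Sum>v\<in>F. (cmod (coord (f n) v - coord (f m) v))\<^sup>2) \<le> e\<^sup>2"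
        using sum_coord_le_norm[OF \<open>finite F\<close>, of "f n - f m"] power_mono[OF M[of m], of 2]
        by (simp add: coord_minus)
    qed
  qed simp
  obtain M where "\<And>m n. m \<ge> M \<Longrightarrow> n \<ge> M \<Longrightarrow> dist (f m) (f n) < 1"
    using cauchy unfolding Cauchy_def by (metis zero_less_one)
  then have "(\<lambda>v. (cmod (coord (f M) v - h v))\<^sup>2) summable_on UNIV"
    by (intro square_summable_bound[where b = "1\<^sup>2"] tail[where M = M]) (auto simp: dist_norm less_imp_le)
  \<comment> \<open>Here \<open>h\<close> is written as \<open>- (f M - h) + f M\<close>, a sum of
    two square-summable functions.\<close>
  from square_summable_add[OF square_summable_mult[OF this, of "-1"] coord_summable[of "f M"]]
  have hs: "(\<lambda>v. (cmod (h v))\<^sup>2) summable_on UNIV"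
    by simp
  have "f \<longlonglongrightarrow> Abs_ell2 h"
  proof (rule metric_LIMSEQ_I)
    fix e :: real assume "e > 0"
    \<comment> \<open>Passing to the limit keeps only a non-strict inequality; half of
      \<open>e\<close> leaves room for the strict one.\<close>
    then obtain M where M: "\<And>m n. m \<ge> M \<Longrightarrow> n \<ge> M \<Longrightarrow> dist (f m) (f n) < e / 2"
      using cauchy unfolding Cauchy_def by (metis half_gt_zero)
    have "norm (f n - Abs_ell2 h) \<le> e / 2" if "n \<ge> M" for n
    proof (rule norm_ell2_le)
      fix F :: "'a set" assume "finite F"
      then show "(\<Sum>v\<in>F. (cmod (coord (f n - Abs_ell2 h) v))\<^sup>2) \<le> (e / 2)\<^sup>2"
        using tail[of F M n "e/2"] M[OF that]
        by (simp add: coord_minus coord_Abs[OF hs] dist_norm less_imp_le)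
    qed (use \<open>e > 0\<close> in simp)
    then show "\<exists>no. \<forall>n\<ge>no. dist (f n) (Abs_ell2 h) < e"
      using \<open>e > 0\<close> by (intro exI[of _ M]) (force simp: dist_norm)
  qed
  then show "convergent f"
    by (auto simp: convergent_def)
qed

section \<open>Complex scalar multiples and resolvents\<close>

lemma scaleC_diff: "scaleC c (f - g) = scaleC c f - scaleC c g"
  by (rule ell2_eqI) (simp add: coord_scaleC coord_minus algebra_simps)

lemma norm_scaleC_le: "norm (scaleC c f) \<le> cmod c * norm f"
proof (rule norm_ell2_le)
  fix F :: "'a set" assume "finite F"
  then show "(\<Sum>v\<in>F. (cmod (coord (scaleC c f) v))\<^sup>2) \<le> (cmod c * norm f)\<^sup>2"
    using mult_left_mono[OF sum_coord_le_norm[of F f], of "(cmod c)\<^sup>2"]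
    by (simp add: coord_scaleC norm_mult power_mult_distrib sum_distrib_left)
qed simp

lemma scaleC_scaleC: "scaleC a (scaleC b f) = scaleC (a * b) f"
  by (rule ell2_eqI) (simp add: coord_scaleC)

lemma scaleC_one: "scaleC 1 f = f"
  by (rule ell2_eqI) (simp add: coord_scaleC)

text \<open>The reverse inequality is \<open>norm_scaleC_le\<close> for the inverse scalar. The
  class \<open>real_inner\<close> itself yields homogeneity for real scalars only.\<close>

lemma norm_scaleC: "norm (scaleC c f) = cmod c * norm f"
proof (cases "c = 0")
  case True
  then show ?thesis using norm_scaleC_le[of c f] by simp
next
  case False
  then have "norm f \<le> cmod (inverse c) * norm (scaleC c f)"
    using norm_scaleC_le[of "inverse c" "scaleC c f"] by (simp add: scaleC_scaleC scaleC_one)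
  then show ?thesis
    using False norm_scaleC_le[of c f] by (simp add: norm_divide field_simps)
qed

lemma scaleC_in_ell2_on: "f \<in> ell2_on V \<Longrightarrow> scaleC c f \<in> ell2_on V"
  by (simp add: ell2_on_def coord_scaleC)

text \<open>The equation \<open>lam f - T f = g\<close> is the fixed point equation of the contraction
  \<open>f \<mapsto> lam\<inverse> (g + T f)\<close>.\<close>

lemma resolvent_set_norm_less:
  assumes lin: "bounded_linear T" and inv: "\<And>f. f \<in> ell2_on V \<Longrightarrow> T f \<in> ell2_on V"
    and b: "\<And>f. norm (T f) \<le> b * norm f" "0 \<le> b" "b < cmod lam"
  shows "lam \<in> resolvent_set (ell2_on V) T"
proof -
  interpret T: bounded_linear T by (rule lin)
  let ?H = "ell2_on V" and ?U = "\<lambda>f. scaleC lam f - T f"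
  have lam: "lam \<noteq> 0" using b by auto
  \<comment> \<open>This lower bound is used twice: for injectivity, and at the end for the norm of
    the inverse.\<close>
  have lower: "(cmod lam - b) * norm f \<le> norm (?U f)" for f
    using norm_triangle_ineq2[of "scaleC lam f" "T f"] b(1)[of f]
    by (simp add: norm_scaleC algebra_simps)
  have U_diff: "?U (f - g) = ?U f - ?U g" for f g
    by (simp add: scaleC_diff T.diff)
  have inj: "inj_on ?U ?H"
  proof (rule inj_onI)
    fix f g assume "?U f = ?U g"
    then have "(cmod lam - b) * norm (f - g) \<le> 0"
      using lower[of "f - g"] by (simp only: U_diff) simp
    then show "f = g"
      using b by (simp add: mult_le_0_iff)
  qed
  have surj: "\<exists>f\<in>?H. ?U f = g" if g: "g \<in> ?H" for g
  proof -
    let ?\<Phi> = "\<lambda>f. scaleC (inverse lam) (g + T f)"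
    have "\<exists>!f\<in>?H. ?\<Phi> f = f"
    proof (rule Banach_fix[where c = "b / cmod lam"])
      show "complete ?H"
        by (simp add: complete_eq_closed closed_ell2_on)
      show "?H \<noteq> {}" using g by auto
      show "0 \<le> b / cmod lam" "b / cmod lam < 1"
        using b lam by simp_all
      show "?\<Phi> ` ?H \<subseteq> ?H"
        using g inv by (auto intro!: scaleC_in_ell2_on subspace_add subspace_ell2_on)
      fix f h
      have "?\<Phi> f - ?\<Phi> h = scaleC (inverse lam) (T (f - h))"
        by (simp flip: scaleC_diff add: T.diff)
      then have "dist (?\<Phi> f) (?\<Phi> h) = norm (T (f - h)) / cmod lam"
        by (simp add: dist_norm norm_scaleC norm_inverse divide_inverse)
      also have "\<dots> \<le> b * norm (f - h) / cmod lam"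
        by (intro divide_right_mono b) simp
      finally show "dist (?\<Phi> f) (?\<Phi> h) \<le> b / cmod lam * dist f h"
        by (simp add: dist_norm)
    qed
    then obtain f where f: "f \<in> ?H" "?\<Phi> f = f" by auto
    then have "scaleC lam f = scaleC lam (?\<Phi> f)" by simp
    also have "\<dots> = g + T f"
      using lam by (simp add: scaleC_scaleC scaleC_one)
    finally show ?thesis using f(1) by (intro bexI[of _ f]) auto
  qed
  have U_in: "?U f \<in> ?H" if "f \<in> ?H" for f
    using that inv by (intro subspace_diff subspace_ell2_on scaleC_in_ell2_on)
  have img: "?U ` ?H = ?H"
    using U_in surj by (auto simp: image_iff)
  then have bij: "bij_betw ?U ?H ?H"
    using inj by (simp add: bij_betw_def)
  have "norm (inv_into ?H ?U f) \<le> inverse (cmod lam - b) * norm f" if "f \<in> ?H" for f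
    using lower[of "inv_into ?H ?U f"] f_inv_into_f[of f ?U ?H] that img b
    by (simp add: field_simps)
  then show ?thesis
    using bij by (auto simp: resolvent_set_def boundedly_invertible_on_def)
qed

lemma resolvent_props:
  assumes "lam \<in> resolvent_set H T"
  shows "f \<in> H \<Longrightarrow> resolvent H T lam f \<in> H"
    and "f \<in> H \<Longrightarrow> scaleC lam (resolvent H T lam f) - T (resolvent H T lam f) = f"
    and "f \<in> H \<Longrightarrow> resolvent H T lam (scaleC lam f - T f) = f"
proof -
  have bij: "bij_betw (\<lambda>f. scaleC lam f - T f) H H"
    using assms by (simp add: resolvent_set_def boundedly_invertible_on_def)
  show "resolvent H T lam f \<in> H" if "f \<in> H"
    using bij that by (auto simp: resolvent_def bij_betw_def intro: inv_into_into)
  show "scaleC lam (resolvent H T lam f) - T (resolvent H T lam f) = f" if "f \<in> H"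
    unfolding resolvent_def using bij_betw_inv_into_right[OF bij that] .
  show "resolvent H T lam (scaleC lam f - T f) = f" if "f \<in> H"
    unfolding resolvent_def using bij_betw_inv_into_left[OF bij that] .
qed

text \<open>The value of a resolvent is identified by exhibiting a preimage in \<open>H\<close>. The
  formula of the theorem is verified in this way.\<close>

lemma resolvent_eqI:
  assumes "lam \<in> resolvent_set H T" "f \<in> H" "scaleC lam f - T f = g"
  shows "resolvent H T lam g = f"
  using resolvent_props(3)[OF assms(1,2)] unfolding assms(3) .

text \<open>The sum of the two values is a preimage of \<open>f + g\<close>, and preimages in
  \<open>H\<close> are unique. This has to be derived because \<open>resolvent\<close> is defined by
  \<open>inv_into\<close>.\<close>

lemma resolvent_add:
  assumes lam: "lam \<in> resolvent_set H T" and "subspace H" "bounded_linear T"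
    and fg: "f \<in> H" "g \<in> H"
  shows "resolvent H T lam (f + g) = resolvent H T lam f + resolvent H T lam g"
proof (rule resolvent_eqI[OF lam])
  interpret T: bounded_linear T by fact
  let ?R = "resolvent H T lam"
  show "?R f + ?R g \<in> H"
    using resolvent_props(1)[OF lam] fg \<open>subspace H\<close> by (simp add: subspace_add)
  have "scaleC lam (?R f + ?R g) = scaleC lam (?R f) + scaleC lam (?R g)"
    by (rule ell2_eqI) (simp add: coord_scaleC coord_plus algebra_simps)
  then show "scaleC lam (?R f + ?R g) - T (?R f + ?R g) = f + g"
    using resolvent_props(2)[OF lam fg(1)] resolvent_props(2)[OF lam fg(2)]
    by (simp add: T.add algebra_simps)
qed

section \<open>Column vectors and the orthogonal sum of two spaces\<close>

lemma exists_column_vec: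
  obtains p q where "v = column_vec p q"
proof
  have "(\<lambda>u. (cmod (coord v (Inl u)))\<^sup>2) summable_on UNIV"
    "(\<lambda>u. (cmod (coord v (Inr u)))\<^sup>2) summable_on UNIV"
    using summable_on_subset[OF coord_summable[of v]]
      summable_on_reindex[of Inl UNIV "\<lambda>u. (cmod (coord v u))\<^sup>2"]
      summable_on_reindex[of Inr UNIV "\<lambda>u. (cmod (coord v u))\<^sup>2"] by (auto simp: o_def)
  then show "v = column_vec (Abs_ell2 (\<lambda>u. coord v (Inl u))) (Abs_ell2 (\<lambda>u. coord v (Inr u)))"
    by (intro ell2_eqI) (metis coord_Abs coord_column_vec sumE)
qed

lemma column_vec_eq_iff: "column_vec p q = column_vec p' q' \<longleftrightarrow> p = p' \<and> q = q'"
  by (metis coord_column_vec ell2_eqI)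

lemma column_vec_in_ell2_on:
  "column_vec p q \<in> ell2_on (V <+> W) \<longleftrightarrow> p \<in> ell2_on V \<and> q \<in> ell2_on W"
proof -
  have "column_vec p q \<in> ell2_on (V <+> W) \<longleftrightarrow>
      (\<forall>v. Inl v \<notin> V <+> W \<longrightarrow> coord p v = 0) \<and> (\<forall>v. Inr v \<notin> V <+> W \<longrightarrow> coord q v = 0)"
    unfolding ell2_on_def mem_Collect_eq by (metis coord_column_vec sumE)
  then show ?thesis
    by (auto simp: ell2_on_def)
qed

lemma norm_le_column_vec: "norm p \<le> norm (column_vec p q)"
proof (rule norm_ell2_le)
  fix F :: "'a set" assume "finite F"
  then show "(\<Sum>v\<in>F. (cmod (coord p v))\<^sup>2) \<le> (norm (column_vec p q))\<^sup>2"
    using sum_coord_le_norm[of "Inl ` F" "column_vec p q"]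
    by (simp add: sum.reindex coord_column_vec)
qed simp

text \<open>Together with \<open>norm_le_column_vec\<close>, this passes a bound for the resolvent
  of \<open>Ap\<close> on to the first component of its value at a vector
  \<open>column_vec w 0\<close>.\<close>

lemma norm_column_vec_zero: "norm (column_vec p 0) \<le> norm p"
proof (rule norm_ell2_le)
  fix F :: "('a + 'b) set" assume F: "finite F"
  have "(\<Sum>v\<in>F. (cmod (coord (column_vec p (0 :: 'b ell2)) v))\<^sup>2) =
      (\<Sum>v\<in>Inl ` (Inl -` F). (cmod (coord (column_vec p (0 :: 'b ell2)) v))\<^sup>2)"
  proof (rule sum.mono_neutral_right[OF F])
    show "\<forall>v\<in>F - Inl ` (Inl -` F). (cmod (coord (column_vec p (0 :: 'b ell2)) v))\<^sup>2 = 0"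
    proof
      fix v assume "v \<in> F - Inl ` (Inl -` F)"
      then show "(cmod (coord (column_vec p (0 :: 'b ell2)) v))\<^sup>2 = 0"
        by (cases v) (auto simp: coord_column_vec coord_zero)
    qed
  qed auto
  also have "\<dots> = (\<Sum>v\<in>Inl -` F. (cmod (coord p v))\<^sup>2)"
    by (subst sum.reindex) (simp_all add: coord_column_vec)
  also have "\<dots> \<le> (norm p)\<^sup>2"
    using F by (intro sum_coord_le_norm finite_vimageI) auto
  finally show "(\<Sum>v\<in>F. (cmod (coord (column_vec p (0 :: 'b ell2)) v))\<^sup>2) \<le> (norm p)\<^sup>2" .
qed simp

section \<open>Boundedness of adjacency operators and of matrices dominated by them\<close>

text \<open>With \<open>m\<close> the degree bound, one factor \<open>m\<close> comes from
  Cauchy-Schwarz on each neighbourhood and a second one from double counting the edges; hence the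
  square of \<open>m\<close> on the right.\<close>

lemma norm_adj_sum_le:
  assumes "bounded_degree_graph Y"
  obtains m :: real where "m \<ge> 0"
    "\<And>f F. finite F \<Longrightarrow> (\<Sum>u\<in>F. (cmod (\<Sum>v | adj Y u v. coord f v))\<^sup>2) \<le> (m * norm f)\<^sup>2"
proof -
  let ?N = "\<lambda>u. {v. adj Y u v}"
  from assms obtain m where m: "\<And>v. v \<in> verts Y \<Longrightarrow> finite (?N v) \<and> card (?N v) \<le> m"
    and "simple_graph Y"
    by (auto simp: bounded_degree_graph_def)
  then have sym: "adj Y u v \<longleftrightarrow> adj Y v u" and out: "v \<notin> verts Y \<Longrightarrow> ?N v = {}" for u v
    by (auto simp: simple_graph_def)
  \<comment> \<open>A point outside \<open>verts Y\<close> has no neighbours, so the degree bound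
    extends to the whole type.\<close>
  have fin: "finite (?N v)" and card: "card (?N v) \<le> m" for v
    using m[of v] out[of v] by (cases "v \<in> verts Y"; simp)+
  have "(\<Sum>u\<in>F. (cmod (\<Sum>v\<in>?N u. coord f v))\<^sup>2) \<le> (real m * norm f)\<^sup>2" if F: "finite F" for f F
  proof -
    let ?U = "\<Union>u\<in>F. ?N u"
    have "(cmod (\<Sum>v\<in>?N u. coord f v))\<^sup>2 \<le> real m * (\<Sum>v\<in>?N u. (cmod (coord f v))\<^sup>2)" for u
    proof -
      have "(cmod (\<Sum>v\<in>?N u. coord f v))\<^sup>2 \<le> (\<Sum>v\<in>?N u. cmod (coord f v))\<^sup>2"
        by (intro power_mono norm_sum) simp
      also have "\<dots> \<le> (\<Sum>v\<in>?N u. (cmod (coord f v))\<^sup>2) * real (card (?N u))"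
        using fin by (intro sum_squared_le_sum_of_squares)
      also have "\<dots> \<le> (\<Sum>v\<in>?N u. (cmod (coord f v))\<^sup>2) * real m"
        using card by (intro mult_left_mono) (auto intro: sum_nonneg)
      finally show ?thesis by (simp add: mult.commute)
    qed
    then have "(\<Sum>u\<in>F. (cmod (\<Sum>v\<in>?N u. coord f v))\<^sup>2)
        \<le> real m * (\<Sum>u\<in>F. \<Sum>v\<in>?N u. (cmod (coord f v))\<^sup>2)"
      unfolding sum_distrib_left by (rule sum_mono)
    also have "(\<Sum>u\<in>F. \<Sum>v\<in>?N u. (cmod (coord f v))\<^sup>2)
        = (\<Sum>u\<in>F. \<Sum>v\<in>{v\<in>?U. adj Y u v}. (cmod (coord f v))\<^sup>2)"
      by (intro sum.cong) auto
    \<comment> \<open>After the interchange each vertex \<open>v\<close> is counted once per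
      neighbour in \<open>F\<close>. By symmetry of adjacency there are at most \<open>m\<close> of
      these.\<close>
    also have "\<dots> = (\<Sum>v\<in>?U. \<Sum>u\<in>{u\<in>F. adj Y u v}. (cmod (coord f v))\<^sup>2)"
      using F fin by (intro sum.swap_restrict) auto
    also have "\<dots> \<le> (\<Sum>v\<in>?U. real m * (cmod (coord f v))\<^sup>2)"
    proof (rule sum_mono)
      fix v
      have "card {u\<in>F. adj Y u v} \<le> card (?N v)"
        using fin[of v] by (intro card_mono) (auto simp: sym[of _ v])
      then show "(\<Sum>u\<in>{u\<in>F. adj Y u v}. (cmod (coord f v))\<^sup>2) \<le> real m * (cmod (coord f v))\<^sup>2"
        using card[of v] by (auto intro!: mult_right_mono)
    qed
    also have "\<dots> \<le> real m * (norm f)\<^sup>2"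
      unfolding sum_distrib_left[symmetric]
      using F fin by (intro mult_left_mono sum_coord_le_norm) auto
    finally show ?thesis
      by (simp add: power2_eq_square mult.assoc mult_left_mono mult.left_commute)
  qed
  then show ?thesis
    by (intro that[of "real m"]) auto
qed

lemma finite_neighbours:
  assumes "bounded_degree_graph Y"
  shows "finite {v. adj Y u v}"
proof (cases "u \<in> verts Y")
  case True
  then show ?thesis using assms by (auto simp: bounded_degree_graph_def)
next
  case False
  then have "{v. adj Y u v} = {}"
    using assms by (auto simp: bounded_degree_graph_def simple_graph_def)
  then show ?thesis by simp
qed

text \<open>The bound on finite sums shows that the image is square-summable, so that
  \<open>Abs_ell2\<close> has its intended value, and it also bounds the norm. Finite rows make
  every coordinate a finite sum, whence linearity.\<close>

lemma bounded_linear_matrix_op: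
  assumes rows: "\<And>w. finite {v. M w v \<noteq> 0}"
    and bound: "\<And>f F. finite F \<Longrightarrow>
      (\<Sum>w\<in>F. (cmod (\<Sum>\<^sub>\<infinity>v. of_real (M w v) * coord f v))\<^sup>2) \<le> (b * norm f)\<^sup>2"
    and "0 \<le> b"
  shows "coord (matrix_op M f) w = (\<Sum>\<^sub>\<infinity>v. of_real (M w v) * coord f v)"
    and "norm (matrix_op M f) \<le> b * norm f"
    and "bounded_linear (matrix_op M)"
proof -
  have coord: "coord (matrix_op M f) w = (\<Sum>\<^sub>\<infinity>v. of_real (M w v) * coord f v)" for f w
    unfolding matrix_op_def by (subst coord_Abs) (rule square_summable_bound[OF bound] refl | assumption)+
  then show "coord (matrix_op M f) w = (\<Sum>\<^sub>\<infinity>v. of_real (M w v) * coord f v)" .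
  have norm: "norm (matrix_op M f) \<le> b * norm f" for f
    using bound \<open>0 \<le> b\<close> by (intro norm_ell2_le) (simp_all add: coord)
  then show "norm (matrix_op M f) \<le> b * norm f" .
  have sum: "(\<lambda>v. of_real (M w v) * coord f v) summable_on UNIV" for f w
    by (rule finite_nonzero_values_imp_summable_on) (rule finite_subset[OF _ rows[of w]], auto)
  show "bounded_linear (matrix_op M)"
  proof (rule bounded_linear_intro[where K = b])
    show "matrix_op M (f + g) = matrix_op M f + matrix_op M g" for f g
      by (rule ell2_eqI) (simp add: coord coord_plus distrib_left infsum_add sum)
    show "matrix_op M (r *\<^sub>R f) = r *\<^sub>R matrix_op M f" for r f
      by (rule ell2_eqI) (simp add: coord coord_scaleR mult.left_commute[of _ "of_real r"]
          infsum_cmult_right sum)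
    show "norm (matrix_op M f) \<le> norm f * b" for f
      using norm[of f] by (simp add: mult.commute)
  qed
qed

lemma infsum_adj_matrix:
  assumes "bounded_degree_graph Y"
  shows "(\<Sum>\<^sub>\<infinity>v. of_real (adj_matrix Y u v) * f v) = (\<Sum>v | adj Y u v. f v :: complex)"
proof -
  have "(\<Sum>\<^sub>\<infinity>v. of_real (adj_matrix Y u v) * f v) = (\<Sum>\<^sub>\<infinity>v\<in>{v. adj Y u v}. f v)"
    by (rule infsum_cong_neutral) (auto simp: adj_matrix_def)
  then show ?thesis
    using finite_neighbours[OF assms] by simp
qed

text \<open>Boundedness makes \<open>onorm (adj_op Y)\<close> a genuine bound, and so allows it to
  be compared with the norms of the blocks.\<close>

lemma adj_op_bounded:
  assumes "bounded_degree_graph Y"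
  shows "bounded_linear (adj_op Y)"
    and "coord (adj_op Y f) u = (\<Sum>v | adj Y u v. coord f v)"
proof -
  obtain m where m: "m \<ge> 0"
    "\<And>f F. finite F \<Longrightarrow> (\<Sum>u\<in>F. (cmod (\<Sum>v | adj Y u v. coord f v))\<^sup>2) \<le> (m * norm f)\<^sup>2"
    using norm_adj_sum_le[OF assms] by blast
  have rows: "finite {v. adj_matrix Y u v \<noteq> 0}" for u
    using finite_neighbours[OF assms] by (simp add: adj_matrix_def)
  show "bounded_linear (adj_op Y)"
    unfolding adj_op_def
    by (rule bounded_linear_matrix_op(3)[where b = m]) (use m rows in \<open>simp_all add: infsum_adj_matrix[OF assms]\<close>)
  show "coord (adj_op Y f) u = (\<Sum>v | adj Y u v. coord f v)"
    unfolding adj_op_def infsum_adj_matrix[OF assms, symmetric]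
    by (rule bounded_linear_matrix_op(1)[where b = m]) (use m rows in \<open>simp_all add: infsum_adj_matrix[OF assms]\<close>)
qed

text \<open>Replacing \<open>f\<close> by \<open>\<bar>f\<bar>\<close>, transported along \<open>j\<close>, reduces the estimate to the operator norm
  of \<open>Y\<close>.\<close>

lemma dominated_matrix_op:
  fixes Y :: "'y ugraph" and M :: "'w \<Rightarrow> 'v \<Rightarrow> real"
  assumes Y: "bounded_degree_graph Y" and "inj i" "inj j"
    and dom: "\<And>w v. \<bar>M w v\<bar> \<le> adj_matrix Y (i w) (j v)"
  shows "(\<lambda>v. of_real (M w v) * coord f v) summable_on UNIV"
    and "coord (matrix_op M f) w = (\<Sum>\<^sub>\<infinity>v. of_real (M w v) * coord f v)"
    and "norm (matrix_op M f) \<le> onorm (adj_op Y) * norm f"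
    and "bounded_linear (matrix_op M)"
    and "matrix_op M f \<in> ell2_on (i -` verts Y)"
proof -
  let ?N = "\<lambda>w. {v. adj Y (i w) (j v)}"
  have finN: "finite (?N w)" for w
    using finite_vimageI[OF finite_neighbours[OF Y, of "i w"] \<open>inj j\<close>] by (simp add: vimage_def)
  have supp: "M w v = 0" if "v \<notin> ?N w" for w v
    using dom[of w v] that by (simp add: adj_matrix_def)
  have rows: "finite {v. M w v \<noteq> 0}" for w
    using supp by (intro finite_subset[OF _ finN[of w]]) auto
  show "(\<lambda>v. of_real (M w v) * coord f v) summable_on UNIV"
    by (rule finite_nonzero_values_imp_summable_on) (rule finite_subset[OF _ rows[of w]], auto)
  have bound: "(\<Sum>w\<in>F. (cmod (\<Sum>\<^sub>\<infinity>v. of_real (M w v) * coord f v))\<^sup>2) \<le> (onorm (adj_op Y) * norm f)\<^sup>2"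
    if F: "finite F" for f F
  proof -
    define h :: "'y \<Rightarrow> complex"
      where "h y = (if y \<in> range j then of_real (cmod (coord f (inv_into UNIV j y))) else 0)" for y
    have h_j: "h (j v) = of_real (cmod (coord f v))" for v
      using \<open>inj j\<close> by (simp add: h_def)
    have h_sum: "(\<Sum>y\<in>E. (cmod (h y))\<^sup>2) \<le> (norm f)\<^sup>2" if E: "finite E" for E
    proof -
      have "(\<Sum>y\<in>E. (cmod (h y))\<^sup>2) = (\<Sum>y\<in>j ` (j -` E). (cmod (h y))\<^sup>2)"
        using E by (intro sum.mono_neutral_right) (auto simp: h_def)
      also have "\<dots> = (\<Sum>v\<in>j -` E. (cmod (coord f v))\<^sup>2)"
        using \<open>inj j\<close> by (subst sum.reindex) (auto simp: h_j intro: inj_on_subset)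
      also have "\<dots> \<le> (norm f)\<^sup>2"
        using E \<open>inj j\<close> by (intro sum_coord_le_norm finite_vimageI)
      finally show ?thesis .
    qed
    have coord_h: "coord (Abs_ell2 h) = h"
      by (rule coord_Abs[OF square_summable_bound[OF h_sum]])
    have norm_h: "norm (Abs_ell2 h) \<le> norm f"
      by (rule norm_ell2_le) (simp_all add: coord_h h_sum)
    \<comment> \<open>The entries of \<open>M\<close> are at most 1 in absolute value and live on
      \<open>?N w\<close>, so the triangle inequality leaves the sum of the
      \<open>cmod (coord f v)\<close> there. As \<open>h\<close> is nonnegative and vanishes off
      \<open>range j\<close>, this sum is exactly the coordinate of
      \<open>adj_op Y (Abs_ell2 h)\<close> at \<open>i w\<close>.\<close>
    have le: "cmod (\<Sum>\<^sub>\<infinity>v. of_real (M w v) * coord f v) \<le> cmod (coord (adj_op Y (Abs_ell2 h)) (i w))" for w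
    proof -
      have "(\<Sum>\<^sub>\<infinity>v. of_real (M w v) * coord f v) = (\<Sum>\<^sub>\<infinity>v\<in>?N w. of_real (M w v) * coord f v)"
        by (rule infsum_cong_neutral) (auto simp: supp)
      also have "\<dots> = (\<Sum>v\<in>?N w. of_real (M w v) * coord f v)"
        using finN by simp
      also have "cmod \<dots> \<le> (\<Sum>v\<in>?N w. cmod (coord f v))"
      proof (rule sum_norm_le)
        fix v
        have "\<bar>M w v\<bar> \<le> 1"
          using dom[of w v] by (simp add: adj_matrix_def split: if_splits)
        then show "cmod (of_real (M w v) * coord f v) \<le> cmod (coord f v)"
          by (simp add: norm_mult mult_left_le_one_le)
      qed
      finally have "cmod (\<Sum>\<^sub>\<infinity>v. of_real (M w v) * coord f v) \<le> (\<Sum>v\<in>?N w. cmod (coord f v))" .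
      moreover have "(\<Sum>y | adj Y (i w) y. h y) = (\<Sum>y\<in>j ` ?N w. h y)"
        using finite_neighbours[OF Y] by (intro sum.mono_neutral_right) (auto simp: h_def)
      moreover have "(\<Sum>y\<in>j ` ?N w. h y) = of_real (\<Sum>v\<in>?N w. cmod (coord f v))"
        using \<open>inj j\<close> by (subst sum.reindex) (auto simp: h_j intro: inj_on_subset)
      ultimately show ?thesis
        by (simp add: adj_op_bounded(2)[OF Y] coord_h sum_nonneg del: of_real_sum)
    qed
    have "(\<Sum>w\<in>F. (cmod (\<Sum>\<^sub>\<infinity>v. of_real (M w v) * coord f v))\<^sup>2)
        \<le> (\<Sum>w\<in>F. (cmod (coord (adj_op Y (Abs_ell2 h)) (i w)))\<^sup>2)"
      by (intro sum_mono power_mono le) simp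
    also have "\<dots> = (\<Sum>y\<in>i ` F. (cmod (coord (adj_op Y (Abs_ell2 h)) y))\<^sup>2)"
      using \<open>inj i\<close> by (subst sum.reindex) (auto intro: inj_on_subset)
    also have "\<dots> \<le> (norm (adj_op Y (Abs_ell2 h)))\<^sup>2"
      using F by (intro sum_coord_le_norm) simp
    also have "\<dots> \<le> (onorm (adj_op Y) * norm f)\<^sup>2"
    proof (rule power_mono)
      have "norm (adj_op Y (Abs_ell2 h)) \<le> onorm (adj_op Y) * norm (Abs_ell2 h)"
        by (rule onorm[OF adj_op_bounded(1)[OF Y]])
      also have "\<dots> \<le> onorm (adj_op Y) * norm f"
        by (intro mult_left_mono norm_h onorm_pos_le adj_op_bounded(1)[OF Y])
      finally show "norm (adj_op Y (Abs_ell2 h)) \<le> onorm (adj_op Y) * norm f" .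
    qed simp
    finally show ?thesis .
  qed
  note op = bounded_linear_matrix_op[where M = M, OF rows bound onorm_pos_le[OF adj_op_bounded(1)[OF Y]]]
  show "coord (matrix_op M f) w = (\<Sum>\<^sub>\<infinity>v. of_real (M w v) * coord f v)"
    and "norm (matrix_op M f) \<le> onorm (adj_op Y) * norm f"
    and "bounded_linear (matrix_op M)"
    by (rule op; assumption)+
  have "M w v = 0" if "w \<notin> i -` verts Y" for w v
    using that Y supp[of v w] by (auto simp: bounded_degree_graph_def simple_graph_def)
  then show "matrix_op M f \<in> ell2_on (i -` verts Y)"
    by (auto simp: ell2_on_def op(1))
qed

section \<open>Block decomposition and the Schur complement\<close>

lemma infsum_sum_type:
  fixes f :: "'a + 'b \<Rightarrow> complex"
  assumes "(\<lambda>u. f (Inl u)) summable_on UNIV" "(\<lambda>u. f (Inr u)) summable_on UNIV"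
  shows "(\<Sum>\<^sub>\<infinity>v. f v) = (\<Sum>\<^sub>\<infinity>u. f (Inl u)) + (\<Sum>\<^sub>\<infinity>u. f (Inr u))"
proof -
  have "f summable_on range Inl" "f summable_on range Inr"
    using assms by (simp_all add: summable_on_reindex o_def)
  then have "infsum f (range Inl \<union> range Inr) = infsum f (range Inl) + infsum f (range Inr)"
    by (rule infsum_Un_disjoint) auto
  then show ?thesis
    by (simp add: UNIV_sum infsum_reindex o_def)
qed

text \<open>Translation by \<open>s\<close> maps \<open>U\<close> into itself and commutes with
  closure. It keeps vectors in \<open>W\<close> when a value of \<open>S\<close> is added, since
  these values lie in the sum of ranges before closure.\<close>

lemma add_in_closure_subspace:
  fixes U :: "'a::real_normed_vector set"
  assumes "subspace U" "s \<in> U" "w \<in> closure U"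
  shows "w + s \<in> closure U"
proof -
  have "(+) s ` U \<subseteq> U"
    using assms by (auto intro: subspace_add)
  then have "(+) s ` closure U \<subseteq> closure U"
    by (metis closure_mono closure_translation)
  then show ?thesis
    using assms(3) by (auto simp: add.commute)
qed

text \<open>\<open>(I - S)\<inverse> w = (lam - A) p\<close>, where \<open>p\<close> is the first component of the resolvent of \<open>A\<^sub>p\<close>
  at \<open>(w, 0)\<close>.\<close>

lemma schur_complement_resolvent:
  fixes A D :: "'x ell2 \<Rightarrow> 'x ell2" and B :: "'g ell2 \<Rightarrow> 'g ell2"
    and C :: "'g ell2 \<Rightarrow> 'x ell2" and Ct :: "'x ell2 \<Rightarrow> 'g ell2"
    and Ap :: "('x + 'g) ell2 \<Rightarrow> ('x + 'g) ell2"
  assumes HX: "subspace HX" "closed HX" and HG: "subspace HG"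
    and HXC: "\<forall>f\<in>HX. scaleC lam f \<in> HX"
    and lin: "bounded_linear A" "bounded_linear B" "bounded_linear C" "bounded_linear Ct" "bounded_linear D"
    and maps: "\<And>f. A f \<in> HX" "\<And>f. D f \<in> HX" "\<And>g. C g \<in> HX" "\<And>f. Ct f \<in> HG"
    and Ap: "\<And>p q. Ap (column_vec p q) = column_vec (A p + D p + C q) (Ct p + B q)"
    and HY: "\<And>p q. column_vec p q \<in> HY \<longleftrightarrow> p \<in> HX \<and> q \<in> HG"
    and rY: "lam \<in> resolvent_set HY Ap" and rA: "lam \<in> resolvent_set HX A"
    and rB: "lam \<in> resolvent_set HG B"
  defines "RA \<equiv> resolvent HX A lam" and "RB \<equiv> resolvent HG B lam"
    and "W \<equiv> closure {a + b |a b. a \<in> C ` HG \<and> b \<in> D ` HX}"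
  defines "S \<equiv> \<lambda>f. D (RA f) + C (RB (Ct (RA f)))"
  shows "S ` W \<subseteq> W"
    and "boundedly_invertible_on W (\<lambda>f. f - S f)"
    and "x \<in> HX \<Longrightarrow> y \<in> HG \<Longrightarrow>
      z = inv_into W (\<lambda>f. f - S f) ((D (RA x) + C (RB (Ct (RA x)))) + C (RB y)) \<Longrightarrow>
      resolvent HY Ap lam (column_vec x y) =
        column_vec (RA (x + z)) (RB (Ct (RA x) + y + Ct (RA z)))"
proof -
  interpret A: bounded_linear A by fact
  interpret B: bounded_linear B by fact
  interpret C: bounded_linear C by fact
  interpret Ct: bounded_linear Ct by fact
  interpret D: bounded_linear D by fact
  let ?W0 = "{a + b |a b. a \<in> C ` HG \<and> b \<in> D ` HX}"
  note RA_in = resolvent_props(1)[OF rA, folded RA_def]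
    and RA_eq = resolvent_props(2)[OF rA, folded RA_def]
    and RB_in = resolvent_props(1)[OF rB, folded RB_def]
    and RB_eq = resolvent_props(2)[OF rB, folded RB_def]
    and RA_add = resolvent_add[OF rA HX(1) lin(1), folded RA_def]
    and RB_add = resolvent_add[OF rB HG lin(2), folded RB_def]
    and RA_I = resolvent_eqI[OF rA, folded RA_def]
    and RB_I = resolvent_eqI[OF rB, folded RB_def]
  have scaleC_col: "scaleC lam (column_vec p q) = column_vec (scaleC lam p) (scaleC lam q)"
    for p :: "'x ell2" and q :: "'g ell2"
  proof (rule ell2_eqI)
    show "coord (scaleC lam (column_vec p q)) v =
        coord (column_vec (scaleC lam p) (scaleC lam q)) v" for v
      by (cases v) (simp_all add: coord_column_vec coord_scaleC)
  qed
  have diff_col: "column_vec p q - column_vec p' q' = column_vec (p - p') (q - q')"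
    for p p' :: "'x ell2" and q q' :: "'g ell2"
  proof (rule ell2_eqI)
    show "coord (column_vec p q - column_vec p' q') v =
        coord (column_vec (p - p') (q - q')) v" for v
      by (cases v) (simp_all add: coord_column_vec coord_minus)
  qed
  have block: "scaleC lam (column_vec p q) - Ap (column_vec p q) =
      column_vec (scaleC lam p - A p - D p - C q) (scaleC lam q - B q - Ct p)" for p q
    by (simp add: Ap scaleC_col diff_col diff_diff_eq add_ac)
  have sub0: "subspace ?W0"
    using HX(1) HG by (intro subspace_sums linear_subspace_image C.linear D.linear)
  have W0_HX: "?W0 \<subseteq> HX"
    using maps HX(1) by (auto intro: subspace_add)
  then have W_HX: "W \<subseteq> HX"
    unfolding W_def using HX(2) by (rule closure_minimal)
  have S_W0: "S f \<in> ?W0" if "f \<in> HX" for f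
  proof -
    have "C (RB (Ct (RA f))) + D (RA f) \<in> ?W0"
      using RA_in RB_in maps that by blast
    then show ?thesis by (simp add: S_def add.commute)
  qed
  have W0_W: "?W0 \<subseteq> W"
    unfolding W_def by (rule closure_subset)
  show SW: "S ` W \<subseteq> W"
    using S_W0 W_HX W0_W by blast
  have W_add: "w + s \<in> W" if "w \<in> W" "s \<in> ?W0" for w s
    using that sub0 unfolding W_def by (intro add_in_closure_subspace)
  let ?U = "\<lambda>f. f - S f"
  have U_in: "?U f \<in> W" if "f \<in> W" for f
  proof -
    have "f + (- S f) \<in> W"
      using that W_HX S_W0 subspace_neg[OF sub0] by (intro W_add) auto
    then show ?thesis by simp
  qed
  \<comment> \<open>The second row is solved by \<open>RB (Ct (RA f))\<close>; substituting this
    into the first row leaves \<open>f - S f\<close>. Thus \<open>f - S f\<close> determines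
    \<open>RA f\<close>, and hence \<open>f\<close>, which gives injectivity.\<close>
  have RY: "resolvent HY Ap lam (column_vec (?U f) 0) = column_vec (RA f) (RB (Ct (RA f)))"
    if "f \<in> HX" for f
  proof (rule resolvent_eqI[OF rY])
    show "column_vec (RA f) (RB (Ct (RA f))) \<in> HY"
      using that maps by (simp add: HY RA_in RB_in)
    have "scaleC lam (RB (Ct (RA f))) - B (RB (Ct (RA f))) = Ct (RA f)"
      by (intro RB_eq maps)
    then show "scaleC lam (column_vec (RA f) (RB (Ct (RA f)))) - Ap (column_vec (RA f) (RB (Ct (RA f))))
        = column_vec (?U f) 0"
      using RA_eq[OF that] by (simp add: block S_def diff_diff_eq)
  qed
  have inj: "inj_on ?U W"
  proof (rule inj_onI)
    fix f g assume f: "f \<in> W" and g: "g \<in> W" and eq: "?U f = ?U g"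
    have "column_vec (RA f) (RB (Ct (RA f))) = column_vec (RA g) (RB (Ct (RA g)))"
      using RY[of f] RY[of g] f g W_HX unfolding eq by (metis subsetD)
    then have "RA f = RA g"
      by (simp add: column_vec_eq_iff)
    then show "f = g"
      using RA_eq f g W_HX by (metis subsetD)
  qed
  \<comment> \<open>Nothing is said about the sign of \<open>k\<close>, so its absolute value enters
    the estimates below.\<close>
  obtain k where k: "\<And>v. v \<in> HY \<Longrightarrow> norm (resolvent HY Ap lam v) \<le> k * norm v"
    using rY by (auto simp: resolvent_set_def boundedly_invertible_on_def resolvent_def)
  obtain a where a: "a \<ge> 0" "\<And>f. norm (A f) \<le> norm f * a"
    using A.nonneg_bounded by blast
  have solve: "\<exists>f\<in>W. ?U f = w \<and> norm f \<le> (cmod lam + a) * \<bar>k\<bar> * norm w" if w: "w \<in> W" for w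
  proof -
    have wY: "column_vec w 0 \<in> HY"
      using w W_HX HG by (auto simp: HY subspace_0)
    obtain p q where pq: "resolvent HY Ap lam (column_vec w 0) = column_vec p q"
      using exists_column_vec by blast
    have p: "p \<in> HX" and q: "q \<in> HG"
      using resolvent_props(1)[OF rY wY] by (simp_all add: pq HY)
    from resolvent_props(2)[OF rY wY]
    have eq1: "scaleC lam p - A p - D p - C q = w" and eq2: "scaleC lam q - B q - Ct p = 0"
      by (simp_all add: pq block column_vec_eq_iff)
    \<comment> \<open>This choice gives \<open>RA f = p\<close>, and the second row gives
      \<open>RB (Ct p) = q\<close>. Therefore \<open>S f = D p + C q\<close>, and the first row
      becomes \<open>f - S f = w\<close>.\<close>
    define f where "f = scaleC lam p - A p"
    have f_HX: "f \<in> HX"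
      unfolding f_def using p maps HXC HX(1) by (intro subspace_diff) auto
    have "RA f = p"
      using p by (intro RA_I) (simp_all add: f_def)
    moreover have "RB (Ct p) = q"
      using q eq2 by (intro RB_I) (simp_all add: algebra_simps)
    ultimately have Sf: "S f = D p + C q"
      by (simp add: S_def)
    then have Uf: "?U f = w"
      using eq1 by (simp add: f_def algebra_simps)
    then have "f = w + S f" by (simp add: algebra_simps)
    then have "f \<in> W"
      using W_add[OF w S_W0[OF f_HX]] by simp
    have "norm p \<le> k * norm (column_vec w (0 :: 'g ell2))"
      using norm_le_column_vec[of p q] k[OF wY] by (simp add: pq)
    also have "\<dots> \<le> \<bar>k\<bar> * norm w"
      using norm_column_vec_zero[of w] by (intro mult_mono) auto
    finally have np: "norm p \<le> \<bar>k\<bar> * norm w" .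
    have "norm f \<le> (cmod lam + a) * norm p"
      unfolding f_def using norm_triangle_ineq4[of "scaleC lam p" "A p"] a(2)[of p]
      by (simp add: norm_scaleC algebra_simps)
    also have "\<dots> \<le> (cmod lam + a) * (\<bar>k\<bar> * norm w)"
      using np a(1) by (intro mult_left_mono) auto
    finally show ?thesis
      using \<open>f \<in> W\<close> Uf by (auto simp: mult.assoc)
  qed
  have img: "?U ` W = W"
  proof
    show "W \<subseteq> ?U ` W"
    proof
      fix w assume "w \<in> W"
      then obtain f where "f \<in> W" "?U f = w"
        using solve by blast
      then show "w \<in> ?U ` W" by (intro image_eqI[OF sym])
    qed
    show "?U ` W \<subseteq> W"
      by (rule image_subsetI) (rule U_in)
  qed
  have "norm (inv_into W ?U w) \<le> (cmod lam + a) * \<bar>k\<bar> * norm w" if w: "w \<in> W" for w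
  proof -
    obtain f where f: "f \<in> W" "?U f = w" "norm f \<le> (cmod lam + a) * \<bar>k\<bar> * norm w"
      using solve[OF w] by blast
    then have "inv_into W ?U w = f"
      using inv_into_f_f[OF inj f(1)] by simp
    then show ?thesis using f(3) by simp
  qed
  then show "boundedly_invertible_on W ?U"
    using inj img by (auto simp: boundedly_invertible_on_def bij_betw_def)
  show "resolvent HY Ap lam (column_vec x y) =
      column_vec (RA (x + z)) (RB (Ct (RA x) + y + Ct (RA z)))"
    if x: "x \<in> HX" and y: "y \<in> HG"
      and z: "z = inv_into W ?U ((D (RA x) + C (RB (Ct (RA x)))) + C (RB y))" for x y z
  proof (rule resolvent_eqI[OF rY])
    let ?r = "(D (RA x) + C (RB (Ct (RA x)))) + C (RB y)"
    \<comment> \<open>The two terms in the range of \<open>C\<close> are merged into one image, to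
      match the shape of \<open>?W0\<close>.\<close>
    have "C (RB (Ct (RA x)) + RB y) + D (RA x) \<in> ?W0"
      using x y RA_in RB_in maps subspace_add[OF HG] by blast
    then have "?r \<in> W"
      using W0_W by (auto simp: C.add add_ac)
    then have "?r \<in> ?U ` W"
      using img by simp
    then have zW: "z \<in> W" and Uz: "z - S z = ?r"
      unfolding z by (rule inv_into_into, rule f_inv_into_f)
    have zX: "z \<in> HX" using zW W_HX by auto
    let ?p = "RA (x + z)" and ?q = "RB (Ct (RA x) + y + Ct (RA z))"
    have xz: "x + z \<in> HX" using x zX HX(1) by (simp add: subspace_add)
    have rhs: "Ct (RA x) + y \<in> HG" "Ct (RA x) + y + Ct (RA z) \<in> HG"
      using y maps HG by (simp_all add: subspace_add)
    show "column_vec ?p ?q \<in> HY"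
      using xz rhs by (simp add: HY RA_in RB_in)
    have p_add: "?p = RA x + RA z"
      using x zX by (rule RA_add)
    have "?q = RB (Ct (RA x)) + RB y + RB (Ct (RA z))"
      using rhs y maps by (simp add: RB_add)
    \<comment> \<open>By additivity the terms in \<open>x\<close> and \<open>y\<close> make up
      \<open>?r\<close> and those in \<open>z\<close> make up \<open>S z\<close>. The equation for
      \<open>z\<close> collapses the total to \<open>z\<close>, which cancels against
      \<open>x + z\<close> in the first row.\<close>
    then have "D ?p + C ?q = ?r + S z"
      by (simp add: p_add D.add C.add S_def add_ac)
    also have "\<dots> = z"
      using Uz by (simp add: algebra_simps)
    finally have "scaleC lam ?p - A ?p - D ?p - C ?q = x"
      using RA_eq[OF xz] by (simp add: diff_diff_eq)
    moreover have "scaleC lam ?q - B ?q - Ct ?p = y"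
      using RB_eq[OF rhs(2)] by (simp add: p_add Ct.add)
    ultimately show "scaleC lam (column_vec ?p ?q) - Ap (column_vec ?p ?q) = column_vec x y"
      by (simp add: block)
  qed
qed

section \<open>Application to the blocks of the adjacency operator of \<open>Y\<close>\<close>

theorem proposition6p4:
  fixes X :: "'x ugraph" and G :: "'g ugraph" and Y :: "('x + 'g) ugraph"
    and d :: "'x \<Rightarrow> 'x \<Rightarrow> real" and c :: "'x \<Rightarrow> 'g \<Rightarrow> real"
    and HX :: "'x ell2 set" and HG :: "'g ell2 set" and HY :: "('x + 'g) ell2 set"
    and A D :: "'x ell2 \<Rightarrow> 'x ell2" and B :: "'g ell2 \<Rightarrow> 'g ell2"
    and C :: "'g ell2 \<Rightarrow> 'x ell2" and Ct :: "'x ell2 \<Rightarrow> 'g ell2"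
    and Ap :: "('x + 'g) ell2 \<Rightarrow> ('x + 'g) ell2"
    and RA :: "complex \<Rightarrow> 'x ell2 \<Rightarrow> 'x ell2" and RB :: "complex \<Rightarrow> 'g ell2 \<Rightarrow> 'g ell2"
    and W :: "'x ell2 set" and S :: "complex \<Rightarrow> 'x ell2 \<Rightarrow> 'x ell2"
    and formula_holds :: "complex \<Rightarrow> bool"
  assumes X: "bounded_degree_graph X" and G: "bounded_degree_graph G"
    and Y: "bounded_degree_graph Y"
    and verts_Y: "verts Y = verts X <+> verts G"
    and adj_Y: "adj_matrix Y =
          block_matrix (\<lambda>u v. adj_matrix X u v + d u v) c (\<lambda>g u. c u g) (adj_matrix G)"
    and d_nonneg: "\<And>u v. 0 \<le> d u v"
    and periodic: "essentially_periodic_graph X"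
    and HX: "HX = ell2_on (verts X)" and HG: "HG = ell2_on (verts G)"
    and HY: "HY = ell2_on (verts Y)"
    and A: "A = adj_op X" and B: "B = adj_op G" and Ap: "Ap = adj_op Y"
    and D: "D = matrix_op d" and C: "C = matrix_op c" and Ct: "Ct = matrix_op (\<lambda>g u. c u g)"
    and RA: "RA = resolvent HX A" and RB: "RB = resolvent HG B"
    and W: "W = closure {a + b |a b. a \<in> C ` HG \<and> b \<in> D ` HX}"
    and S: "S = (\<lambda>lam f. D (RA lam f) + C (RB lam (Ct (RA lam f))))"
    and formula_holds: "\<And>lam. formula_holds lam \<longleftrightarrow>
          lam \<in> resolvent_set HY Ap \<and> lam \<in> resolvent_set HX A \<and> lam \<in> resolvent_set HG B \<and>
          S lam ` W \<subseteq> W \<and> boundedly_invertible_on W (\<lambda>f. f - S lam f) \<and>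
          (\<forall>x\<in>HX. \<forall>y\<in>HG.
             let z = inv_into W (\<lambda>f. f - S lam f)
                       ((D (RA lam x) + C (RB lam (Ct (RA lam x)))) + C (RB lam y))
             in resolvent HY Ap lam (column_vec x y) =
                  column_vec (RA lam (x + z)) (RB lam (Ct (RA lam x) + y + Ct (RA lam z))))"
  shows "(finite_perturbation (map_graph Inl X) Y \<longrightarrow>
            (\<forall>lam. onorm Ap < cmod lam \<longrightarrow> formula_holds lam)) \<and>
         ((\<exists>K. amenable_exhaustion X K \<and>
               density_zero_perturbation (\<lambda>n. map_graph Inl (K n)) (map_graph Inl X) Y) \<longrightarrow>
            (\<exists>L. \<forall>lam. L < cmod lam \<longrightarrow> formula_holds lam))"
proof -
  have ent: "adj_matrix Y a b =
      block_matrix (\<lambda>u v. adj_matrix X u v + d u v) c (\<lambda>g u. c u g) (adj_matrix G) a b" for a b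
    by (simp add: adj_Y)
  have entries: "adj_matrix Y (Inl u) (Inl v) = adj_matrix X u v + d u v"
    "adj_matrix Y (Inl u) (Inr g) = c u g" "adj_matrix Y (Inr g) (Inl u) = c u g"
    "adj_matrix Y (Inr g) (Inr h) = adj_matrix G g h" for u v g h
    by (simp_all add: ent block_matrix_def)
  \<comment> \<open>Nonnegativity of \<open>c\<close> is inherited from \<open>adj_matrix Y\<close>,
    of which each \<open>c u g\<close> is an entry.\<close>
  have nonneg: "0 \<le> adj_matrix X u v" "0 \<le> adj_matrix Y a b" "0 \<le> adj_matrix G g h" "0 \<le> c u g"
    for u v a b g h
    by (simp_all add: adj_matrix_def flip: entries(2))
  have vimage: "Inl -` verts Y = verts X" "Inr -` verts Y = verts G"
    by (auto simp: verts_Y)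
  \<comment> \<open>Both summands of \<open>adj_matrix X u v + d u v\<close> are nonnegative, so
    each is dominated by the sum: no cancellation can make \<open>Ap\<close> smaller than
    \<open>A\<close> or \<open>D\<close>.\<close>
  have "\<bar>adj_matrix X u v\<bar> \<le> adj_matrix Y (Inl u) (Inl v)" for u v
    by (simp add: entries nonneg d_nonneg)
  note opA = dominated_matrix_op[OF Y inj_Inl inj_Inl this, folded adj_op_def,
      folded A Ap, unfolded vimage, folded HX]
  have "\<bar>d u v\<bar> \<le> adj_matrix Y (Inl u) (Inl v)" for u v
    by (simp add: entries nonneg d_nonneg)
  note opD = dominated_matrix_op[OF Y inj_Inl inj_Inl this,
      folded D Ap, unfolded vimage, folded HX]
  have "\<bar>c u g\<bar> \<le> adj_matrix Y (Inl u) (Inr g)" for u g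
    by (simp add: entries nonneg)
  note opC = dominated_matrix_op[OF Y inj_Inl inj_Inr this,
      folded C Ap, unfolded vimage, folded HX]
  have "\<bar>c u g\<bar> \<le> adj_matrix Y (Inr g) (Inl u)" for u g
    by (simp add: entries nonneg)
  note opCt = dominated_matrix_op[OF Y inj_Inr inj_Inl this,
      folded Ct Ap, unfolded vimage, folded HG]
  have "\<bar>adj_matrix G g h\<bar> \<le> adj_matrix Y (Inr g) (Inr h)" for g h
    by (simp add: entries nonneg)
  note opB = dominated_matrix_op[OF Y inj_Inr inj_Inr this, folded adj_op_def,
      folded B Ap, unfolded vimage, folded HG]
  \<comment> \<open>The matrix of \<open>Y\<close> dominates itself along the identity, which yields
    the same list of facts for \<open>Ap\<close>.\<close>
  have "\<bar>adj_matrix Y a b\<bar> \<le> adj_matrix Y (id a) (id b)" for a b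
    by (simp add: nonneg)
  note opY = dominated_matrix_op[OF Y inj_on_id inj_on_id this, folded adj_op_def,
      folded Ap, unfolded vimage_id id_apply, folded HY]
  have block: "Ap (column_vec p q) = column_vec (A p + D p + C q) (Ct p + B q)" for p q
  proof (rule ell2_eqI)
    fix v
    show "coord (Ap (column_vec p q)) v = coord (column_vec (A p + D p + C q) (Ct p + B q)) v"
    proof (cases v)
      case (Inl u)
      have "(\<Sum>\<^sub>\<infinity>w. of_real (adj_matrix Y (Inl u) w) * coord (column_vec p q) w) =
          (\<Sum>\<^sub>\<infinity>w. of_real (adj_matrix X u w) * coord p w + of_real (d u w) * coord p w) +
          (\<Sum>\<^sub>\<infinity>w. of_real (c u w) * coord q w)"
        \<comment> \<open>Summability over each half of the disjoint union is what permits splitting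
          the infinite sum.\<close>
        using summable_on_add[OF opA(1) opD(1), of u p u p] opC(1)
        by (subst infsum_sum_type) (simp_all add: entries coord_column_vec distrib_right)
      then show ?thesis
        by (simp add: Inl opY(2) opA(2) opC(2) opD(2) coord_column_vec coord_plus
            infsum_add opA(1) opD(1))
    next
      case (Inr g)
      have "(\<Sum>\<^sub>\<infinity>w. of_real (adj_matrix Y (Inr g) w) * coord (column_vec p q) w) =
          (\<Sum>\<^sub>\<infinity>w. of_real (c w g) * coord p w) + (\<Sum>\<^sub>\<infinity>w. of_real (adj_matrix G g w) * coord q w)"
        using opCt(1) opB(1)
        by (subst infsum_sum_type) (simp_all add: entries coord_column_vec)
      then show ?thesis
        by (simp add: Inr opY(2) opB(2) opCt(2) coord_column_vec coord_plus)
    qed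
  qed
  have mem_HY: "column_vec p q \<in> HY \<longleftrightarrow> p \<in> HX \<and> q \<in> HG" for p q
    by (simp add: HX HG HY verts_Y column_vec_in_ell2_on)
  have "formula_holds lam" if lam: "onorm Ap < cmod lam" for lam
  proof -
    have pos: "0 \<le> onorm Ap"
      by (rule onorm_pos_le[OF opY(4)])
    have rY: "lam \<in> resolvent_set HY Ap"
      using opY(5) unfolding HY
      by (intro resolvent_set_norm_less[OF opY(4) _ opY(3) pos lam]) simp
    have rA: "lam \<in> resolvent_set HX A"
      using opA(4) opA(5) opA(3) pos lam unfolding HX by (rule resolvent_set_norm_less)
    have rB: "lam \<in> resolvent_set HG B"
      using opB(4) opB(5) opB(3) pos lam unfolding HG by (rule resolvent_set_norm_less)
    have sub: "subspace HX" "closed HX" "subspace HG" "\<forall>f\<in>HX. scaleC lam f \<in> HX"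
      by (simp_all add: HX HG subspace_ell2_on closed_ell2_on scaleC_in_ell2_on)
    note schur = schur_complement_resolvent[OF sub opA(4) opB(4) opC(4) opCt(4) opD(4)
        opA(5) opD(5) opC(5) opCt(5) block mem_HY rY rA rB, folded RA RB, folded W]
    show ?thesis
      unfolding formula_holds Let_def S
    proof (intro conjI ballI)
      fix x y assume "x \<in> HX" "y \<in> HG"
      from schur(3)[OF this refl]
      show "resolvent HY Ap lam (column_vec x y) = column_vec
          (RA lam (x + inv_into W (\<lambda>f. f - (D (RA lam f) + C (RB lam (Ct (RA lam f)))))
            (D (RA lam x) + C (RB lam (Ct (RA lam x))) + C (RB lam y))))
          (RB lam (Ct (RA lam x) + y +
            Ct (RA lam (inv_into W (\<lambda>f. f - (D (RA lam f) + C (RB lam (Ct (RA lam f)))))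
            (D (RA lam x) + C (RB lam (Ct (RA lam x))) + C (RB lam y))))))" .
    qed (fact rY rA rB schur(1) schur(2))+
  qed
  then show ?thesis by blast
qed

end
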